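(* Let $\mathcal B$ be a unital C*-algebra and let $\mathcal A\subseteq\mathcal B$ be a unital C*-subalgebra (containing the unit of $\mathcal B$). Then $\mathcal A$ has the TR$(2,2)$-property in $\mathcal B$.
   Context: For self-adjoint elements $a_1,a_2$ of a unital C*-algebra, $a_1<a_2$ means $a_2-a_1\ge\delta 1$ for some scalar $\delta>0$. $\mathcal A$ has the $(n,k)$-tight Riesz interpolation property in $\mathcal B$ (TR$(n,k)$-property) if for all self-adjoint $x_1,\dots,x_n,y_1,\dots,y_k\in\mathcal A$: whenever there is a self-adjoint $b\in\mathcal B$ with $x_i<b<y_j$ for all $i=1,\dots,n$, $j=1,\dots,k$, there is a self-adjoint $a\in\mathcal A$ with $x_i<a<y_j$ for all $i=1,\dots,n$, $j=1,\dots,k$. *)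

theory Defs
  imports Complex_Main
begin

(* Building on real_normed_algebra and monoid_mult rather than real_normed_algebra_1 keeps
   the zero algebra, in which 1 = 0; if 1 is nonzero, norm 1 = 1 follows from the C*-identity. *)
class unital_cstar_algebra = real_normed_algebra + monoid_mult + complete_space +
  fixes scaleC :: "complex \<Rightarrow> 'a \<Rightarrow> 'a"  (infixr "*\<^sub>C" 75)
    and star :: "'a \<Rightarrow> 'a"
  assumes scaleR_scaleC: "r *\<^sub>R x = complex_of_real r *\<^sub>C x"
    and scaleC_add_right: "c *\<^sub>C (x + y) = c *\<^sub>C x + c *\<^sub>C y"
    and scaleC_add_left: "(c + d) *\<^sub>C x = c *\<^sub>C x + d *\<^sub>C x"
    and scaleC_scaleC: "c *\<^sub>C d *\<^sub>C x = (c * d) *\<^sub>C x"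
    and scaleC_one: "1 *\<^sub>C x = x"
    and mult_scaleC_left: "(c *\<^sub>C x) * y = c *\<^sub>C (x * y)"
    and mult_scaleC_right: "x * (c *\<^sub>C y) = c *\<^sub>C (x * y)"
    and norm_scaleC: "norm (c *\<^sub>C x) = cmod c * norm x"
    and star_star: "star (star x) = x"
    and star_add: "star (x + y) = star x + star y"
    and star_scaleC: "star (c *\<^sub>C x) = cnj c *\<^sub>C star x"
    and star_mult: "star (x * y) = star y * star x"
    and cstar_identity: "norm (star x * x) = (norm x)\<^sup>2"

definition selfadjoint :: "'a::unital_cstar_algebra \<Rightarrow> bool" where
  "selfadjoint a \<longleftrightarrow> star a = a"

definition unital_cstar_subalgebra :: "'a::unital_cstar_algebra set \<Rightarrow> bool" where
  "unital_cstar_subalgebra A \<longleftrightarrow>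
     1 \<in> A \<and>
     (\<forall>x\<in>A. \<forall>y\<in>A. x + y \<in> A) \<and>
     (\<forall>c. \<forall>x\<in>A. c *\<^sub>C x \<in> A) \<and>
     (\<forall>x\<in>A. \<forall>y\<in>A. x * y \<in> A) \<and>
     (\<forall>x\<in>A. star x \<in> A) \<and>
     closed A"

(* The order is taken inside the C*-algebra C under consideration: the witness c for
   positivity is required to lie in C itself, not merely in an ambient algebra. *)
definition cstar_positive :: "'a::unital_cstar_algebra set \<Rightarrow> 'a \<Rightarrow> bool" where
  "cstar_positive C a \<longleftrightarrow> (\<exists>c\<in>C. a = star c * c)"

definition cstar_le :: "'a::unital_cstar_algebra set \<Rightarrow> 'a \<Rightarrow> 'a \<Rightarrow> bool" where
  "cstar_le C a b \<longleftrightarrow> cstar_positive C (b - a)"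

definition cstar_less :: "'a::unital_cstar_algebra set \<Rightarrow> 'a \<Rightarrow> 'a \<Rightarrow> bool" where
  "cstar_less C a b \<longleftrightarrow> (\<exists>\<delta>>0. cstar_le C (\<delta> *\<^sub>R 1) (b - a))"

definition TR_property ::
    "nat \<Rightarrow> nat \<Rightarrow> 'a::unital_cstar_algebra set \<Rightarrow> 'a set \<Rightarrow> bool" where
  "TR_property n k A B \<longleftrightarrow>
     (\<forall>x y :: nat \<Rightarrow> 'a.
        (\<forall>i\<in>{1..n}. x i \<in> A \<and> selfadjoint (x i)) \<longrightarrow>
        (\<forall>j\<in>{1..k}. y j \<in> A \<and> selfadjoint (y j)) \<longrightarrow>
        (\<exists>b\<in>B. selfadjoint b \<and>
           (\<forall>i\<in>{1..n}. \<forall>j\<in>{1..k}. cstar_less B (x i) b \<and> cstar_less B b (y j))) \<longrightarrow>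
        (\<exists>a\<in>A. selfadjoint a \<and>
           (\<forall>i\<in>{1..n}. \<forall>j\<in>{1..k}. cstar_less A (x i) a \<and> cstar_less A a (y j))))"

end

theory Submission
  imports Defs "HOL-Computational_Algebra.Formal_Power_Series"
begin

text \<open>Put \<open>S = (x\<^sub>1 - x\<^sub>2)/2\<close>, \<open>D = (y\<^sub>1 - y\<^sub>2)/2\<close>, \<open>M = (y\<^sub>1 + y\<^sub>2 - x\<^sub>1 - x\<^sub>2)/2\<close>. Subtracting
  \<open>(x\<^sub>1 + x\<^sub>2)/2\<close> from the interpolant turns the problem into splitting \<open>M = E + F\<close> with
  \<open>\<plusminus>S < E\<close> and \<open>\<plusminus>D < F\<close>. Given such a splitting in the large algebra, with \<open>M\<close> diminished by a small
  multiple of the unit, run in the subalgebra the Riccati iteration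
  \<open>m\<^sub>0 = M\<close>, \<open>n\<^sub>k = M - D m\<^sub>k\<^sup>-\<^sup>1 D\<close>, \<open>m\<^sub>k\<^sub>+\<^sub>1 = M - S n\<^sub>k\<^sup>-\<^sup>1 S\<close>. Since \<open>\<plusminus>D \<le> F\<close> gives \<open>D F\<^sup>-\<^sup>1 D \<le> F\<close>, and
  likewise for \<open>S\<close> and \<open>E\<close>, one has \<open>m\<^sub>k \<ge> F\<close> and \<open>n\<^sub>k \<ge> E\<close> throughout, so all inverses exist. The elements
  \<open>(S n\<^sub>k\<^sup>-\<^sup>1 S + n\<^sub>k)/2 \<ge> \<plusminus>S\<close> and \<open>(D m\<^sub>k\<^sup>-\<^sup>1 D + m\<^sub>k)/2 \<ge> \<plusminus>D\<close> lie in the subalgebra and add up to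
  \<open>M + (m\<^sub>k - m\<^sub>k\<^sub>+\<^sub>1)/2\<close>; the error telescopes, so averaging over \<open>k\<close> makes it arbitrarily small.\<close>

instance unital_cstar_algebra \<subseteq> banach ..

section \<open>Square roots in closed subalgebras\<close>

lemma scaleR_half_add_half: "(1/2) *\<^sub>R u + (1/2) *\<^sub>R u = (u::'a::real_vector)"
  by (simp flip: scaleR_add_left)

lemma star_one [simp]: "star (1::'a::unital_cstar_algebra) = 1"
  by (metis mult_1 mult_1_right star_mult star_star)

text \<open>The C*-identity at 1 makes \<open>norm 1\<close> equal to its own square, hence 0 or 1;
  it is 0 in the zero algebra.\<close>

lemma norm_one_le: "norm (1::'a::unital_cstar_algebra) \<le> 1"
proof -
  have "norm (1::'a) * norm (1::'a) \<ge> norm (1::'a)"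
    using norm_mult_ineq[of "1::'a" 1] by simp
  moreover have "(norm (1::'a))\<^sup>2 = norm (1::'a)"
    using cstar_identity[of "1::'a"] by simp
  ultimately show ?thesis
    by (metis mult_cancel_right1 norm_ge_zero order_eq_refl power2_eq_square zero_le_one)
qed

lemma norm_power_le: "norm (x ^ n) \<le> norm (x::'a::unital_cstar_algebra) ^ n"
proof (induction n)
  case 0
  then show ?case by (simp add: norm_one_le)
next
  case (Suc n)
  then show ?case
    by (simp, meson mult_left_mono norm_ge_zero norm_mult_ineq order_trans)
qed

lemma star_scaleR [simp]: "star (r *\<^sub>R x) = r *\<^sub>R star (x::'a::unital_cstar_algebra)"
  by (simp add: scaleR_scaleC star_scaleC)

lemma star_zero [simp]: "star (0::'a::unital_cstar_algebra) = 0"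
  using star_scaleR[of 0 0] by simp

lemma star_minus [simp]: "star (- x) = - star (x::'a::unital_cstar_algebra)"
  using star_scaleR[of "-1" x] by simp

lemma star_diff [simp]: "star (x - y) = star x - star (y::'a::unital_cstar_algebra)"
  using star_add[of x "- y"] by simp

lemma norm_star [simp]: "norm (star x) = norm (x::'a::unital_cstar_algebra)"
proof -
  have *: "norm y \<le> norm (star y)" for y :: 'a
  proof (cases "norm y = 0")
    case False
    have "norm y * norm y \<le> norm (star y) * norm y"
      using cstar_identity[of y] norm_mult_ineq[of "star y" y] by (simp add: power2_eq_square)
    with False show ?thesis
      using norm_ge_zero[of y] by simp
  qed auto
  show ?thesis
    using *[of x] *[of "star x"] by (simp add: star_star)
qed

lemma bounded_linear_star: "bounded_linear (star :: 'a::unital_cstar_algebra \<Rightarrow> 'a)"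
  by (rule bounded_linear_intro[of _ 1]) (auto simp: star_add)

lemma selfadjoint_norm_square:
  "selfadjoint (h::'a::unital_cstar_algebra) \<Longrightarrow> norm (h * h) = (norm h)\<^sup>2"
  using cstar_identity[of h] by (simp add: selfadjoint_def)

text \<open>Weak enough to cover, besides C*-subalgebras, the commutant of any single element: a
  square root built there commutes with that element.\<close>

definition closed_subalgebra :: "'a::unital_cstar_algebra set \<Rightarrow> bool" where
  "closed_subalgebra C \<longleftrightarrow> 1 \<in> C \<and> (\<forall>x\<in>C. \<forall>y\<in>C. x + y \<in> C) \<and> (\<forall>r. \<forall>x\<in>C. r *\<^sub>R x \<in> C)
     \<and> (\<forall>x\<in>C. \<forall>y\<in>C. x * y \<in> C) \<and> closed C"

lemma closed_subalgebraD:
  assumes "closed_subalgebra C"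
  shows "1 \<in> C" "\<And>x y. x \<in> C \<Longrightarrow> y \<in> C \<Longrightarrow> x + y \<in> C" "\<And>r x. x \<in> C \<Longrightarrow> r *\<^sub>R x \<in> C"
    "\<And>x y. x \<in> C \<Longrightarrow> y \<in> C \<Longrightarrow> x * y \<in> C" "closed C"
    "\<And>x y. x \<in> C \<Longrightarrow> y \<in> C \<Longrightarrow> x - y \<in> C" "0 \<in> C"
proof -
  show *: "1 \<in> C" "\<And>x y. x \<in> C \<Longrightarrow> y \<in> C \<Longrightarrow> x + y \<in> C" "\<And>r x. x \<in> C \<Longrightarrow> r *\<^sub>R x \<in> C"
    "\<And>x y. x \<in> C \<Longrightarrow> y \<in> C \<Longrightarrow> x * y \<in> C" "closed C"
    using assms by (auto simp: closed_subalgebra_def)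
  show "x - y \<in> C" if "x \<in> C" "y \<in> C" for x y
    using *(2)[OF that(1) *(3)[OF that(2), of "-1"]] by simp
  show "0 \<in> C"
    using *(3)[OF *(1), of 0] by simp
qed

lemma closed_subalgebra_UNIV: "closed_subalgebra UNIV"
  by (simp add: closed_subalgebra_def)

lemma closed_subalgebra_cstar: "unital_cstar_subalgebra A \<Longrightarrow> closed_subalgebra A"
  by (simp add: unital_cstar_subalgebra_def closed_subalgebra_def scaleR_scaleC)

lemma closed_subalgebra_commutant:
  "closed_subalgebra {x. x * y = y * (x::'a::unital_cstar_algebra)}"
  unfolding closed_subalgebra_def
proof (intro conjI)
  show "closed {x. x * y = y * x}"
    by (intro closed_Collect_eq continuous_intros)
  show "\<forall>u\<in>{x. x * y = y * x}. \<forall>v\<in>{x. x * y = y * x}. u * v \<in> {x. x * y = y * x}"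
    by (auto, metis mult.assoc)
qed (auto simp: distrib_left distrib_right)

lemma closed_subalgebra_sums:
  fixes x :: "'a::unital_cstar_algebra"
  assumes "closed_subalgebra C" "x \<in> C" "(\<lambda>n. c n *\<^sub>R x ^ n) sums s"
  shows "s \<in> C"
proof -
  note C = closed_subalgebraD[OF assms(1)]
  have pow: "x ^ n \<in> C" for n
    by (induction n) (auto intro: C assms)
  have "(\<Sum>k<n. c k *\<^sub>R x ^ k) \<in> C" for n
    by (induction n) (auto intro: C pow)
  then show ?thesis
    using closed_sequentially[OF C(5), of "\<lambda>n. \<Sum>k<n. c k *\<^sub>R x ^ k" s] assms(3)
    unfolding sums_def by blast
qed

lemma selfadjoint_sums:
  fixes x :: "'a::unital_cstar_algebra"
  assumes "selfadjoint x" "(\<lambda>n. c n *\<^sub>R x ^ n) sums s"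
  shows "selfadjoint s"
proof -
  have "star (x ^ n) = x ^ n" for n
    using assms(1) by (induction n) (auto simp: star_mult selfadjoint_def power_commutes)
  then have "(\<lambda>n. c n *\<^sub>R x ^ n) sums star s"
    using bounded_linear.sums[OF bounded_linear_star assms(2)] by simp
  then show ?thesis
    using assms(2) sums_unique2 unfolding selfadjoint_def by blast
qed


section \<open>Coefficients of the binomial series for the square root\<close>

lemma gbinomial_half_sign:
  "(-1) ^ n * ((-1/2::real) gchoose n) \<ge> 0"
  "n > 0 \<Longrightarrow> (-1) ^ n * ((1/2::real) gchoose n) \<le> 0"
proof -
  show *: "(-1) ^ n * ((-1/2::real) gchoose n) \<ge> 0" for n
    using pochhammer_nonneg[of "1/2::real" n]
    by (simp add: gbinomial_pochhammer flip: power_mult_distrib)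
  show "(-1) ^ n * ((1/2::real) gchoose n) \<le> 0" if "n > 0"
  proof (cases n)
    case (Suc m)
    \<comment> \<open>Absorption lowers the index by one and the exponent from 1/2 to -1/2; the lost
      factor -1 reverses the sign.\<close>
    have "(-1) ^ n * ((1/2::real) gchoose n) = - (1 / (2 * real n)) * ((-1) ^ m * ((-1/2) gchoose m))"
      using gbinomial_absorption'[of n "1/2::real"] by (simp add: Suc)
    also have "\<dots> \<le> 0"
      using *[of m] by (simp add: mult_le_0_iff)
    finally show ?thesis .
  qed (use that in simp)
qed

text \<open>The signed terms \<open>(-1) ^ k * (1/2 gchoose k)\<close> are 1 at k = 0 and
  nonpositive afterwards, so a partial sum of absolute values is 2 minus the signed partial sum,
  which has a nonnegative closed form.\<close>

lemma summable_gbinomial_half: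
  "summable (\<lambda>n. \<bar>(1/2::real) gchoose n\<bar>)"
  "(\<Sum>n. \<bar>(1/2::real) gchoose n\<bar>) \<le> 2"
proof -
  have *: "(\<Sum>k\<le>m. \<bar>(1/2::real) gchoose k\<bar>) \<le> 2" for m
  proof -
  have "(\<Sum>k\<le>m. \<bar>(1/2::real) gchoose k\<bar>) \<le> (\<Sum>k\<le>m. (if k = 0 then 2 else 0) - (1/2 gchoose k) * (-1) ^ k)"
  proof (rule sum_mono)
    fix k
    have "\<bar>(1/2::real) gchoose k\<bar> = \<bar>(-1) ^ k * ((1/2::real) gchoose k)\<bar>"
      by (simp add: abs_mult)
    then show "\<bar>(1/2::real) gchoose k\<bar> \<le> (if k = 0 then 2 else 0) - (1/2 gchoose k) * (-1) ^ k"
      using gbinomial_half_sign(2)[of k] by (auto simp: mult.commute)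
  qed
  also have "\<dots> = 2 - (-1) ^ m * ((-1/2::real) gchoose m)"
    by (simp add: sum_subtractf gbinomial_sum_lower_neg)
  also have "\<dots> \<le> 2"
    using gbinomial_half_sign(1)[of m] by simp
  finally show ?thesis .
  qed
  show sm: "summable (\<lambda>n. \<bar>(1/2::real) gchoose n\<bar>)"
    by (rule bounded_imp_summable[OF _ *]) auto
  have "(\<Sum>n<m. \<bar>(1/2::real) gchoose n\<bar>) \<le> 2" for m
    using * by (cases m) (auto simp: lessThan_Suc_atMost)
  then show "(\<Sum>n. \<bar>(1/2::real) gchoose n\<bar>) \<le> 2"
    using sm by (intro suminf_le_const) auto
qed

text \<open>The binomial series of the square root converges absolutely even on the boundary of the
  unit ball.\<close>

lemma sqrt_one_minus:
  fixes x :: "'a::unital_cstar_algebra"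
  assumes "norm x \<le> 1" "selfadjoint x" "closed_subalgebra C" "x \<in> C"
  obtains s where "s \<in> C" "selfadjoint s" "s * s = 1 - x" "norm (1 - s) \<le> 1"
proof -
  define c where "c n = (-1) ^ n * ((1/2::real) gchoose n)" for n
  define f where "f = (\<lambda>n. c n *\<^sub>R x ^ n)"
  have "norm (f n) \<le> \<bar>(1/2::real) gchoose n\<bar>" for n
  proof -
    have "norm (x ^ n) \<le> 1"
      using norm_power_le[of x n] assms(1) by (meson norm_ge_zero order_trans power_le_one)
    then have "\<bar>c n\<bar> * norm (x ^ n) \<le> \<bar>c n\<bar> * 1"
      by (intro mult_left_mono) auto
    then show ?thesis
      by (simp add: f_def c_def abs_mult)
  qed
  note nf = this
  have sm: "summable (\<lambda>n. norm (f n))"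
    by (intro summable_comparison_test'[OF summable_gbinomial_half(1), of 0]) (simp add: nf)
  define s where "s = suminf f"
  have s: "(\<lambda>n. c n *\<^sub>R x ^ n) sums s"
    using summable_sums[OF summable_norm_cancel[OF sm]] by (simp only: s_def f_def)
  \<comment> \<open>Vandermonde convolves two coefficients of exponent 1/2 into one of exponent 1,
    so the Cauchy square of the series is \<open>1 - x\<close>.\<close>
  have "(\<Sum>i\<le>k. f i * f (k - i)) = (if k = 0 then 1 else if k = 1 then - x else 0)" for k
  proof -
    have "(\<Sum>i\<le>k. f i * f (k - i)) = (\<Sum>i\<le>k. (c i * c (k - i)) *\<^sub>R x ^ k)"
      by (intro sum.cong) (auto simp: f_def simp flip: power_add)
    also have "\<dots> = (\<Sum>i\<le>k. c i * c (k - i)) *\<^sub>R x ^ k"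
      by (simp add: scaleR_left.sum)
    also have "(\<Sum>i\<le>k. c i * c (k - i)) = (-1) ^ k * (\<Sum>i\<in>{0..k}. ((1/2) gchoose i) * ((1/2) gchoose (k - i)))"
      unfolding sum_distrib_left atLeast0AtMost
    proof (intro sum.cong refl)
      fix i assume "i \<in> {..k}"
      then have "(-1::real) ^ k = (-1) ^ i * (-1) ^ (k - i)"
        by (simp flip: power_add)
      then show "c i * c (k - i) = (-1) ^ k * (((1/2) gchoose i) * ((1/2) gchoose (k - i)))"
        by (simp add: c_def)
    qed
    also have "\<dots> = (-1) ^ k * ((1::real) gchoose k)"
      by (subst gbinomial_Vandermonde) simp
    also have "(1::real) gchoose k = of_nat (1 choose k)"
      by (simp add: binomial_gbinomial)
    also have "of_nat (1 choose k) = (if k \<le> 1 then 1 else 0 :: real)"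
      by (auto simp: le_Suc_eq)
    finally show ?thesis
      by (auto simp: le_Suc_eq)
  qed
  then have "(\<lambda>k. if k = 0 then 1 else if k = 1 then - x else 0) sums (s * s)"
    using Cauchy_product_sums[OF sm sm] by (simp add: s_def)
  moreover have "(\<lambda>k. if k = 0 then 1 else if k = 1 then - x else 0) sums (\<Sum>k\<in>{0,1::nat}. if k = 0 then 1 else if k = 1 then - x else 0)"
    by (rule sums_finite) auto
  ultimately have "s * s = 1 - x"
    using sums_unique2 by fastforce
  \<comment> \<open>The constant term uses up 1 of the total absolute mass 2. The bound later
    certifies that the root is itself positive.\<close>
  moreover have "norm (1 - s) \<le> 1"
  proof -
    have "s - 1 = (\<Sum>n. f (Suc n))"
      using suminf_split_head[OF summable_norm_cancel[OF sm]] by (simp add: s_def f_def c_def)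
    also have "norm \<dots> \<le> (\<Sum>n. norm (f (Suc n)))"
      using sm by (intro summable_norm) (simp add: summable_Suc_iff[of "\<lambda>n. norm (f n)"])
    also have "\<dots> \<le> (\<Sum>n. \<bar>(1/2::real) gchoose Suc n\<bar>)"
      using sm summable_gbinomial_half(1) nf
      by (intro suminf_le) (auto simp: summable_Suc_iff[of "\<lambda>n. norm (f n)"]
          summable_Suc_iff[of "\<lambda>n. \<bar>(1/2::real) gchoose n\<bar>"])
    also have "\<dots> \<le> 1"
      using suminf_split_head[OF summable_gbinomial_half(1)] summable_gbinomial_half(2) by simp
    finally show ?thesis
      by (simp add: norm_minus_commute)
  qed
  ultimately show thesis
    using that closed_subalgebra_sums[OF assms(3,4) s] selfadjoint_sums[OF assms(2) s] by blast
qed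

text \<open>The norm hypothesis is a spectrum-free form of positivity; division by \<open>t\<close>
  reduces it to the series for \<open>1 - x\<close>. The root satisfies the same criterion with
  \<open>sqrt t\<close>.\<close>

lemma sqrt_exists:
  fixes a :: "'a::unital_cstar_algebra"
  assumes "norm (t *\<^sub>R 1 - a) \<le> t" "selfadjoint a" "closed_subalgebra C" "a \<in> C"
  obtains s where "s \<in> C" "selfadjoint s" "s * s = a" "norm (sqrt t *\<^sub>R 1 - s) \<le> sqrt t"
proof (cases "t = 0")
  case True
  with assms have "a = 0" by simp
  with that[of 0] show thesis
    by (simp add: True closed_subalgebraD[OF assms(3)] selfadjoint_def)
next
  case False
  with assms(1) have t: "t > 0"
    using norm_ge_zero order_trans by (metis order_le_less)
  define x where "x = (1 / t) *\<^sub>R (t *\<^sub>R 1 - a)"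
  have "norm x \<le> 1" "selfadjoint x" "x \<in> C"
    using assms t by (auto simp: x_def selfadjoint_def intro!: closed_subalgebraD[OF assms(3)])
  then obtain s where s: "s \<in> C" "selfadjoint s" "s * s = 1 - x" "norm (1 - s) \<le> 1"
    using sqrt_one_minus assms(3) by blast
  have "(sqrt t *\<^sub>R s) * (sqrt t *\<^sub>R s) = t *\<^sub>R (1 - x)"
    using s t by simp
  also have "\<dots> = a"
    using t by (simp add: x_def scaleR_diff_right)
  finally have "(sqrt t *\<^sub>R s) * (sqrt t *\<^sub>R s) = a" .
  moreover have "norm (sqrt t *\<^sub>R 1 - sqrt t *\<^sub>R s) \<le> sqrt t"
    using s(4) t by (simp add: mult_left_le flip: scaleR_diff_right)
  ultimately show thesis
    using that[of "sqrt t *\<^sub>R s"] s(1,2)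
    by (simp add: closed_subalgebraD[OF assms(3)] selfadjoint_def)
qed

section \<open>The positive cone\<close>

text \<open>Squares of self-adjoint elements, not all \<open>star c * c\<close>: the cone properties
  are then available before the positivity of \<open>star c * c\<close>, whose proof relies on them.
  The witness is unrestricted; \<open>pos_sqrt\<close> places one in any closed subalgebra
  containing the element.\<close>

definition pos :: "'a::unital_cstar_algebra \<Rightarrow> bool" where
  "pos a \<longleftrightarrow> (\<exists>h. selfadjoint h \<and> a = h * h)"

lemma selfadjoint_pos: "pos a \<Longrightarrow> selfadjoint a"
  by (auto simp: pos_def selfadjoint_def star_mult)

lemma pos_square: "selfadjoint h \<Longrightarrow> pos (h * h)"
  by (auto simp: pos_def)

text \<open>For \<open>u = h + i k\<close> commutation gives
  \<open>star u * u = h * h + k * k\<close>, while \<open>h\<close> is the real part of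
  \<open>u\<close>, so its norm is at most that of \<open>u\<close>.\<close>

lemma norm_le_of_commuting_squares:
  fixes h k :: "'a::unital_cstar_algebra"
  assumes "selfadjoint h" "selfadjoint k" "h * k = k * h"
  shows "(norm h)\<^sup>2 \<le> norm (h * h + k * k)"
proof -
  define u where "u = h + \<i> *\<^sub>C k"
  have su: "star u = h - \<i> *\<^sub>C k"
    using assms scaleC_add_left[of "\<i>" "-\<i>" k] scaleR_scaleC[of 0 k]
    by (simp add: u_def star_add star_scaleC selfadjoint_def eq_neg_iff_add_eq_0 add.commute)
  have ii: "\<i> *\<^sub>C \<i> *\<^sub>C x = - x" for x :: 'a
    using scaleR_scaleC[of "-1" x] by (simp add: scaleC_scaleC)
  have diff: "\<i> *\<^sub>C (x - y) = \<i> *\<^sub>C x - \<i> *\<^sub>C y" for x y :: 'a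
    using scaleC_add_right[of "\<i>" "x - y" y] by (simp add: algebra_simps)
  have "star u * u = h * h + k * k"
    unfolding su unfolding u_def
    by (simp add: algebra_simps mult_scaleC_left mult_scaleC_right ii diff scaleC_add_right assms(3))
  then have "(norm u)\<^sup>2 = norm (h * h + k * k)"
    using cstar_identity[of u] by simp
  moreover have "2 *\<^sub>R h = u + star u"
    unfolding su unfolding u_def by (simp add: scaleR_2)
  then have "2 * norm h \<le> 2 * norm u"
    using norm_triangle_ineq[of u "star u"] by (metis abs_numeral mult_2 norm_scaleR norm_star)
  then have "(norm h)\<^sup>2 \<le> (norm u)\<^sup>2"
    by (intro power_mono) auto
  ultimately show ?thesis
    by simp
qed

text \<open>Since \<open>a\<close> has norm at most \<open>t\<close>, the series gives a root
  \<open>s\<close> of \<open>t 1 - a\<close> commuting with the root \<open>h\<close> of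
  \<open>a\<close>. The two squares add up to \<open>t 1\<close>, which bounds each of them.\<close>

lemma pos_norm_le:
  assumes "pos a" "norm a \<le> t"
  shows "norm (t *\<^sub>R 1 - a) \<le> t"
proof -
  obtain h where h: "selfadjoint h" "a = h * h"
    using assms(1) by (auto simp: pos_def)
  have "norm (t *\<^sub>R 1 - (t *\<^sub>R 1 - a)) \<le> t" "selfadjoint (t *\<^sub>R 1 - a)"
    using assms h by (auto simp: selfadjoint_def star_mult)
  moreover have "t *\<^sub>R 1 - a \<in> {x. x * h = h * x}"
    by (simp add: h algebra_simps)
  ultimately obtain s where s: "s * h = h * s" "selfadjoint s" "s * s = t *\<^sub>R 1 - a"
    by (rule sqrt_exists[OF _ _ closed_subalgebra_commutant]) auto
  have "norm (t *\<^sub>R 1 - a) = (norm s)\<^sup>2"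
    using selfadjoint_norm_square[OF s(2)] s by simp
  also have "\<dots> \<le> norm (s * s + h * h)"
    using norm_le_of_commuting_squares s h by blast
  also have "\<dots> = t * norm (1::'a)"
    using s h norm_ge_zero[of a] assms(2) by (simp del: norm_ge_zero)
  also have "\<dots> \<le> t"
    using norm_one_le[where 'a='a] norm_ge_zero[of a] assms(2) by (simp add: mult_left_le del: norm_ge_zero)
  finally show ?thesis .
qed

text \<open>This criterion turns additivity of the cone into the triangle inequality.\<close>

lemma pos_iff: "pos a \<longleftrightarrow> selfadjoint a \<and> (\<exists>t. norm (t *\<^sub>R 1 - a) \<le> t)"
proof safe
  fix t assume "selfadjoint a" "norm (t *\<^sub>R 1 - a) \<le> t"
  then obtain s where "selfadjoint s" "s * s = a"
    using sqrt_exists[OF _ _ closed_subalgebra_UNIV UNIV_I] by blast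
  then show "pos a"
    using pos_square by blast
next
  assume "pos a"
  then show "\<exists>t. norm (t *\<^sub>R 1 - a) \<le> t"
    using pos_norm_le by blast
qed (rule selfadjoint_pos)

lemma pos_sqrt:
  assumes "pos a" "closed_subalgebra C" "a \<in> C"
  obtains s where "s \<in> C" "selfadjoint s" "s * s = a" "pos s"
proof -
  obtain s where s: "s \<in> C" "selfadjoint s" "s * s = a" "norm (sqrt (norm a) *\<^sub>R 1 - s) \<le> sqrt (norm a)"
    by (rule sqrt_exists[OF pos_norm_le[OF assms(1) order_refl] selfadjoint_pos[OF assms(1)] assms(2,3)])
  show thesis
    by (rule that[OF s(1-3)]) (use s in \<open>auto simp: pos_iff\<close>)
qed

lemma pos_add:
  assumes "pos a" "pos b"
  shows "pos (a + b)"
proof -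
  obtain s t where "norm (s *\<^sub>R 1 - a) \<le> s" "norm (t *\<^sub>R 1 - b) \<le> t"
    using assms by (auto simp: pos_iff)
  then have "norm ((s + t) *\<^sub>R 1 - (a + b)) \<le> s + t"
    using norm_triangle_ineq[of "s *\<^sub>R 1 - a" "t *\<^sub>R 1 - b"] by (simp add: algebra_simps)
  then show ?thesis
    using assms by (auto simp: pos_iff selfadjoint_def star_add)
qed

lemma pos_scaleR:
  assumes "pos a" "r \<ge> 0"
  shows "pos (r *\<^sub>R a)"
proof -
  obtain h where h: "selfadjoint h" "a = h * h"
    using assms(1) by (auto simp: pos_def)
  then show ?thesis
    using pos_square[of "sqrt r *\<^sub>R h"] assms by (simp add: selfadjoint_def)
qed

lemma pos_one_scaleR: "r \<ge> 0 \<Longrightarrow> pos (r *\<^sub>R 1)"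
  using pos_scaleR[of 1 r] pos_square[of 1] by (simp add: selfadjoint_def)

lemma pos_norm_minus: "selfadjoint a \<Longrightarrow> norm a \<le> t \<Longrightarrow> pos (t *\<^sub>R 1 - a)"
  by (auto simp: pos_iff selfadjoint_def intro!: exI[of _ t])

text \<open>Again two commuting squares with sum \<open>t 1\<close>, now used to bound the other
  one.\<close>

lemma norm_le_of_pos:
  assumes "pos a" "pos (t *\<^sub>R 1 - a)" "t \<ge> 0"
  shows "norm a \<le> t"
proof -
  obtain h where h: "selfadjoint h" "a = h * h"
    using assms(1) by (auto simp: pos_def)
  have "t *\<^sub>R 1 - a \<in> {x. x * h = h * x}"
    by (simp add: h algebra_simps)
  then obtain s where s: "s * h = h * s" "selfadjoint s" "s * s = t *\<^sub>R 1 - a"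
    by (rule pos_sqrt[OF assms(2) closed_subalgebra_commutant]) auto
  have "norm a = (norm h)\<^sup>2"
    using selfadjoint_norm_square[OF h(1)] h by simp
  also have "\<dots> \<le> norm (h * h + s * s)"
    using norm_le_of_commuting_squares s h by metis
  also have "\<dots> = t * norm (1::'a)"
    using s h assms(3) by simp
  also have "\<dots> \<le> t"
    using norm_one_le[where 'a='a] assms(3) by (simp add: mult_left_le)
  finally show ?thesis .
qed

section \<open>Inverses and positivity of \<open>c\<^sup>*c\<close>\<close>

lemma neumann_inverse:
  fixes x :: "'a::unital_cstar_algebra"
  assumes "norm x < 1" "closed_subalgebra C" "x \<in> C"
  obtains w where "w \<in> C" "(1 - x) * w = 1" "w * (1 - x) = 1"
proof -
  have sm: "summable (\<lambda>n. x ^ n)"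
    by (rule summable_comparison_test'[OF summable_geometric[of "norm x"], of 0])
      (use assms(1) in \<open>auto simp: norm_power_le\<close>)
  define w where "w = (\<Sum>n. x ^ n)"
  have "(\<lambda>n. 1 *\<^sub>R x ^ n) sums w"
    using summable_sums[OF sm] by (simp add: w_def)
  then have "w \<in> C"
    by (rule closed_subalgebra_sums[OF assms(2,3)])
  have split: "(\<Sum>n. x ^ Suc n) = w - 1"
    using suminf_split_head[OF sm] by (simp add: w_def)
  have "x * w = w - 1"
    using suminf_mult[OF sm, of x] split by (simp add: w_def)
  moreover have "w * x = w - 1"
    using suminf_mult2[OF sm, of x] split by (simp add: w_def power_commutes)
  ultimately show thesis
    using that \<open>w \<in> C\<close> by (simp add: algebra_simps)
qed

lemma pos_inverse:
  assumes "pos (a - \<delta> *\<^sub>R 1)" "\<delta> > 0" "closed_subalgebra C" "a \<in> C"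
  obtains v where "v \<in> C" "a * v = 1" "v * a = 1" "pos v"
proof -
  note C = closed_subalgebraD[OF assms(3)]
  have pa: "pos a"
    using pos_add[OF assms(1) pos_one_scaleR[of \<delta>]] assms(2) by simp
  \<comment> \<open>With this \<open>t\<close>, the element \<open>t 1 - a\<close> lies between 0
    and \<open>(t - \<delta>) 1\<close>, so its norm is below \<open>t\<close> and the Neumann
    series inverts \<open>a\<close>.\<close>
  define t where "t = norm a + \<delta>"
  have t: "t > 0" "t - \<delta> \<ge> 0"
    using assms(2) by (auto simp: t_def add_nonneg_pos)
  have "norm (t *\<^sub>R 1 - a) \<le> t - \<delta>"
  proof (rule norm_le_of_pos)
    show "pos (t *\<^sub>R 1 - a)"
      using pos_norm_minus[OF selfadjoint_pos[OF pa], of t] assms(2) by (simp add: t_def)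
    show "pos ((t - \<delta>) *\<^sub>R 1 - (t *\<^sub>R 1 - a))"
      using assms(1) by (simp add: scaleR_diff_left)
  qed (rule t)
  then have "norm (t *\<^sub>R 1 - a) < t"
    using assms(2) by simp
  define x where "x = (1 / t) *\<^sub>R (t *\<^sub>R 1 - a)"
  have "norm x < 1" "x \<in> C"
    using \<open>norm (t *\<^sub>R 1 - a) < t\<close> t by (auto simp: x_def intro!: C assms)
  then obtain w where w: "w \<in> C" "(1 - x) * w = 1" "w * (1 - x) = 1"
    using neumann_inverse assms(3) by blast
  have a: "a = t *\<^sub>R (1 - x)"
    using t by (simp add: x_def scaleR_diff_right)
  define v where "v = (1 / t) *\<^sub>R w"
  have v: "v \<in> C" "a * v = 1" "v * a = 1"
    using w t by (auto simp: v_def a C)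
  obtain h where h: "selfadjoint h" "a = h * h"
    using pa by (auto simp: pos_def)
  have sv: "star v = v"
  proof -
    have "star v * a = 1"
      using v(2) h by (metis selfadjoint_def star_mult star_one)
    then show ?thesis
      using v(2) by (metis mult.assoc mult_1 mult_1_right)
  qed
  \<comment> \<open>The inverse commutes with the root \<open>h\<close> of \<open>a\<close>, so
    \<open>v = v a v\<close> is the square of the self-adjoint \<open>v * h\<close>.\<close>
  have "h * v = v * a * (h * v)"
    using v by simp
  also have "\<dots> = v * h * (a * v)"
    by (simp add: h mult.assoc)
  finally have hv: "h * v = v * h"
    using v by simp
  have "v = (v * h) * (h * v)"
    using v by (metis h(2) mult.assoc mult_1_right)
  then have "v = (v * h) * (v * h)"
    using hv by simp
  moreover have "selfadjoint (v * h)"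
    using h sv hv by (simp add: selfadjoint_def star_mult)
  ultimately have "pos v"
    using pos_square by metis
  with that v show thesis
    by blast
qed

text \<open>The norm of a nonzero positive element lies in its spectrum: if
  \<open>r 1 - p = s * s\<close> had an inverse \<open>g\<close>, then
  \<open>s (1 - \<delta> g) s = s * s - \<delta> 1\<close> would be positive for small
  \<open>\<delta>\<close>, forcing \<open>norm p \<le> r - \<delta>\<close>.\<close>

lemma pos_norm_not_invertible:
  fixes p :: "'a::unital_cstar_algebra"
  assumes "pos p" "(norm p *\<^sub>R 1 - p) * g = 1" "g * (norm p *\<^sub>R 1 - p) = 1"
  shows "p = 0"
proof (rule ccontr)
  assume "p \<noteq> 0"
  define r where "r = norm p"
  have r: "r > 0"
    using \<open>p \<noteq> 0\<close> by (simp add: r_def)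
  obtain s where s: "selfadjoint s" "r *\<^sub>R 1 - p = s * s"
    using pos_norm_minus[OF selfadjoint_pos[OF assms(1)], of r] by (auto simp: r_def pos_def)
  have g: "s * s * g = 1" "g * (s * s) = 1"
    using assms(2,3) s by (auto simp: r_def)
  have gs: "g * s = s * g"
  proof -
    have "g * s = g * s * (s * s * g)"
      using g by simp
    also have "\<dots> = g * (s * s) * (s * g)"
      by (simp only: mult.assoc)
    finally show ?thesis
      using g by simp
  qed
  have "star g = g"
  proof -
    have "star g * (s * s) = 1"
      using g(1) s by (metis selfadjoint_def star_mult star_one)
    then show ?thesis
      using g(1) by (metis mult.assoc mult_1 mult_1_right)
  qed
  \<comment> \<open>The second bound makes \<open>1 - \<delta> g\<close> positive; the first keeps
    \<open>r - \<delta>\<close> nonnegative.\<close>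
  define \<delta> where "\<delta> = min r (1 / (norm g + 1))"
  have \<delta>: "0 < \<delta>" "\<delta> \<le> r" "\<delta> * norm g \<le> 1"
  proof -
    show "0 < \<delta>" "\<delta> \<le> r"
      using r by (auto simp: \<delta>_def add_nonneg_pos)
    have "\<delta> * norm g \<le> 1 / (norm g + 1) * norm g"
      by (intro mult_right_mono) (auto simp: \<delta>_def)
    also have "\<dots> \<le> 1"
      by (auto simp: divide_le_eq_1 add_nonneg_pos)
    finally show "\<delta> * norm g \<le> 1" .
  qed
  have "pos (1 *\<^sub>R 1 - \<delta> *\<^sub>R g)"
    using \<delta> \<open>star g = g\<close> by (intro pos_norm_minus) (auto simp: selfadjoint_def)
  moreover have "1 *\<^sub>R 1 - \<delta> *\<^sub>R g \<in> {x. x * s = s * x}"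
    by (simp add: algebra_simps gs)
  ultimately obtain k where k: "k * s = s * k" "selfadjoint k" "k * k = 1 *\<^sub>R 1 - \<delta> *\<^sub>R g"
    by (rule pos_sqrt[OF _ closed_subalgebra_commutant]) auto
  have "(s * k) * (s * k) = s * (k * k) * s"
    using k(1) by (metis mult.assoc)
  also have "\<dots> = s * s - \<delta> *\<^sub>R 1"
    using g gs by (simp add: k(3) algebra_simps)
  finally have "(s * k) * (s * k) = (r - \<delta>) *\<^sub>R 1 - p"
    using s(2) by (simp add: algebra_simps)
  moreover have "selfadjoint (s * k)"
    using s k by (simp add: selfadjoint_def star_mult)
  ultimately have "pos ((r - \<delta>) *\<^sub>R 1 - p)"
    using pos_square by metis
  then have "norm p \<le> r - \<delta>"
    using norm_le_of_pos[OF assms(1)] \<delta> by simp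
  then show False
    using \<delta> by (simp add: r_def)
qed

text \<open>If \<open>-d\<^sup>*d\<close> is positive then so is \<open>dd\<^sup>*\<close>; as \<open>d\<^sup>*d\<close> and \<open>dd\<^sup>*\<close> have the same nonzero
  spectrum, both vanish.\<close>

lemma star_mult_self_eq_zero:
  fixes d :: "'a::unital_cstar_algebra"
  assumes "pos (- (star d * d))"
  shows "star d * d = 0"
proof -
  define p where "p = - (star d * d)"
  \<comment> \<open>Up to sign, twice the real and imaginary parts of \<open>d\<close>; their
    squares add up to twice \<open>d * star d + star d * d\<close>.\<close>
  define X where "X = d + star d"
  define Y where "Y = \<i> *\<^sub>C (d - star d)"
  have p: "pos p"
    using assms by (simp add: p_def)
  have neg: "(-c) *\<^sub>C x = - (c *\<^sub>C x)" "c *\<^sub>C (- x) = - (c *\<^sub>C x)" for c and x :: 'a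
    using scaleR_scaleC[of "-1" "c *\<^sub>C x"] scaleR_scaleC[of "-1" x]
    by (simp_all add: scaleC_scaleC)
  have "selfadjoint X"
    by (simp add: X_def selfadjoint_def star_add star_star add.commute)
  have "selfadjoint Y"
    using neg(2)[of \<i> "star d - d"] by (simp add: Y_def selfadjoint_def star_scaleC star_star neg(1))
  have "Y * Y = - ((d - star d) * (d - star d))"
    by (simp add: Y_def mult_scaleC_left mult_scaleC_right scaleC_scaleC neg scaleC_one)
  then have "X * X + Y * Y = 2 *\<^sub>R (d * star d - p)"
    by (simp add: X_def p_def algebra_simps scaleR_2)
  then have "d * star d = (1/2) *\<^sub>R (X * X + Y * Y) + p"
    by simp
  then have q: "pos (d * star d)"
    using pos_add pos_scaleR pos_square p \<open>selfadjoint X\<close> \<open>selfadjoint Y\<close>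
    by (metis zero_le_divide_1_iff zero_le_numeral)
  define r where "r = norm p"
  show ?thesis
  proof (cases "r = 0")
    case True
    then show ?thesis by (simp add: r_def p_def)
  next
    case False
    then have r: "r > 0"
      by (simp add: r_def)
    obtain w where w: "(r *\<^sub>R 1 + d * star d) * w = 1" "w * (r *\<^sub>R 1 + d * star d) = 1"
      using pos_inverse[OF _ r closed_subalgebra_UNIV UNIV_I, of "r *\<^sub>R 1 + d * star d"] q by auto
    \<comment> \<open>The standard passage from an inverse \<open>w\<close> of
      \<open>r 1 + d * star d\<close> to one of \<open>r 1 + star d * d\<close>, which is
      \<open>r 1 - p\<close>.\<close>
    define g where "g = (1/r) *\<^sub>R (1 - star d * w * d)"
    have w': "d * (star d * (w * z)) = z - r *\<^sub>R (w * z)" "w * (d * (star d * z)) = z - r *\<^sub>R (w * z)" for z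
      using arg_cong[OF w(1), of "\<lambda>u. u * z"] arg_cong[OF w(2), of "\<lambda>u. u * z"]
      by (auto simp: algebra_simps)
    have "(r *\<^sub>R 1 - p) * g = 1"
      using r by (simp add: g_def p_def algebra_simps w')
    moreover have "g * (r *\<^sub>R 1 - p) = 1"
      using r by (simp add: g_def p_def algebra_simps w')
    ultimately have "p = 0"
      using pos_norm_not_invertible p unfolding r_def by blast
    then show ?thesis
      by (simp add: p_def)
  qed
qed

text \<open>With \<open>s\<close> the modulus of \<open>a = star c * c\<close>, the difference
  \<open>g = s - a\<close> is twice the negative part of \<open>a\<close>, and
  \<open>a g = - s g\<close>. Hence \<open>star (c g) * (c g)\<close> is minus the square of
  \<open>k g\<close>, where \<open>k\<close> is a root of \<open>s\<close>; the preceding lemma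
  kills it, and \<open>g = 0\<close> follows.\<close>

lemma pos_star_mult_self:
  fixes c :: "'a::unital_cstar_algebra"
  shows "pos (star c * c)"
proof -
  define a where "a = star c * c"
  have sa: "star a = a"
    by (simp add: a_def star_mult star_star)
  then have "pos (a * a)"
    by (simp add: pos_square selfadjoint_def)
  then obtain s where s: "s * a = a * s" "selfadjoint s" "s * s = a * a" "pos s"
    by (rule pos_sqrt[OF _ closed_subalgebra_commutant[of a]]) (auto simp: mult.assoc)
  obtain k where k: "k * a = a * k" "selfadjoint k" "k * k = s"
    by (rule pos_sqrt[OF s(4) closed_subalgebra_commutant[of a]]) (auto simp: s)
  define g where "g = s - a"
  have sg: "star g = g"
    using s sa by (simp add: g_def selfadjoint_def)
  have kg: "k * g = g * k"
    by (simp add: g_def algebra_simps k(1) flip: k(3))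
  have ag: "a * g = - (s * g)"
    by (simp add: g_def algebra_simps s)
  have "star (c * g) * (c * g) = g * (a * g)"
    by (simp add: star_mult sg a_def mult.assoc)
  also have "\<dots> = - ((k * g) * (k * g))"
    unfolding ag by (simp add: mult.assoc flip: k(3)) (metis kg mult.assoc)
  finally have e: "star (c * g) * (c * g) = - ((k * g) * (k * g))" .
  have "selfadjoint (k * g)"
    using k sg kg by (simp add: selfadjoint_def star_mult)
  then have "pos (- (star (c * g) * (c * g)))"
    using pos_square e by simp
  then have "(k * g) * (k * g) = 0"
    using star_mult_self_eq_zero e by fastforce
  then have "k * g = 0"
    using selfadjoint_norm_square[OF \<open>selfadjoint (k * g)\<close>] by simp
  then have "s * g = 0"
    by (simp add: mult.assoc flip: k(3))
  then have "g * g = 0"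
    using ag by (simp add: g_def algebra_simps)
  then have "g = 0"
    using selfadjoint_norm_square[of g] sg by (simp add: selfadjoint_def)
  then show ?thesis
    using s(4) by (simp add: g_def a_def)
qed

lemma pos_conjugate: "pos a \<Longrightarrow> pos (star c * a * c)"
proof -
  assume "pos a"
  then obtain h where "star h = h" "a = h * h"
    by (auto simp: pos_def selfadjoint_def)
  then have "star c * a * c = star (h * c) * (h * c)"
    by (simp add: star_mult mult.assoc)
  then show ?thesis
    by (simp only: pos_star_mult_self)
qed

section \<open>Passage between \<open>cstar_less\<close> and the cone \<open>pos\<close>\<close>

lemma cstar_lessE:
  assumes "cstar_less C x y"
  obtains \<delta> where "\<delta> > 0" "pos (y - x - \<delta> *\<^sub>R 1)"
proof -
  obtain \<delta> c where "\<delta> > 0" "y - x - \<delta> *\<^sub>R 1 = star c * c"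
    using assms unfolding cstar_less_def cstar_le_def cstar_positive_def by blast
  then show thesis
    using that pos_star_mult_self[of c] by simp
qed

text \<open>The root of \<open>y - x - \<delta> 1\<close> can be taken inside \<open>C\<close>, so
  positivity in the large algebra yields the order of the subalgebra.\<close>

lemma cstar_lessI:
  assumes "pos (y - x - \<delta> *\<^sub>R 1)" "\<delta> > 0" "closed_subalgebra C" "x \<in> C" "y \<in> C"
  shows "cstar_less C x y"
proof -
  have "y - x - \<delta> *\<^sub>R 1 \<in> C"
    using assms by (intro closed_subalgebraD[OF assms(3)])
  then obtain s where "s \<in> C" "selfadjoint s" "s * s = y - x - \<delta> *\<^sub>R 1"
    using pos_sqrt assms by blast
  then show ?thesis
    using assms(2) unfolding cstar_less_def cstar_le_def cstar_positive_def selfadjoint_def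
    by (intro exI[of _ \<delta>] conjI bexI[of _ s]) auto
qed

section \<open>The Riccati iteration\<close>

text \<open>For \<open>d = q - p\<close>, the positive element \<open>d + d v d\<close> equals
  \<open>q v q - q\<close>; conjugating it by \<open>w\<close> gives \<open>v - w\<close>.\<close>

lemma inverse_antimono:
  fixes p q :: "'a::unital_cstar_algebra"
  assumes "p * v = 1" "v * p = 1" "q * w = 1" "w * q = 1" "pos v" "pos w" "pos (q - p)"
  shows "pos (v - w)"
proof -
  define d where "d = q - p"
  have "star d = d" "star w = w"
    using selfadjoint_pos[OF assms(7)] selfadjoint_pos[OF assms(6)] by (auto simp: d_def selfadjoint_def)
  then have "pos (d + d * v * d)"
    using pos_add[OF assms(7)] pos_conjugate[OF assms(5), of d] by (simp add: d_def)
  then have "pos (w * (d + d * v * d) * w)"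
    using pos_conjugate[of _ w] \<open>star w = w\<close> by simp
  also have "d + d * v * d = q * v * q - q"
    using assms(1,2) by (simp add: d_def algebra_simps)
  also have "w * (q * v * q - q) * w = v - w"
  proof -
    have "w * (q * z) = z" for z
      using assms(4) by (simp flip: mult.assoc)
    then show ?thesis
      using assms(3) by (simp add: algebra_simps)
  qed
  finally show ?thesis .
qed

text \<open>A Schur complement: conjugating \<open>E - S\<close> by \<open>1 + V S\<close> and
  \<open>E + S\<close> by \<open>1 - V S\<close>, the terms odd in \<open>S\<close> cancel in the
  sum.\<close>

lemma pos_schur:
  fixes S E V :: "'a::unital_cstar_algebra"
  assumes "pos (E - S)" "pos (E + S)" "E * V = 1" "V * E = 1" "selfadjoint S" "pos V"
  shows "pos (E - S * V * S)"
proof -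
  have V: "E * (V * z) = z" "V * (E * z) = z" for z
    using assms(3,4) by (simp_all flip: mult.assoc)
  have st: "star S = S" "star V = V"
    using assms selfadjoint_pos by (auto simp: selfadjoint_def)
  have "pos (star (1 + V * S) * (E - S) * (1 + V * S) + star (1 - V * S) * (E + S) * (1 - V * S))"
    by (intro pos_add pos_conjugate assms)
  also have "star (1 + V * S) * (E - S) * (1 + V * S) + star (1 - V * S) * (E + S) * (1 - V * S)
      = 2 *\<^sub>R (E - S * V * S)"
    by (simp add: st star_add star_mult algebra_simps V assms(3,4) scaleR_2)
  finally show ?thesis
    using pos_scaleR[of _ "1/2"] by fastforce
qed

text \<open>Half the expansion of \<open>(S + n) v (S + n)\<close> and of
  \<open>(S - n) v (S - n)\<close>.\<close>

lemma pos_completed_square: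
  fixes S n v :: "'a::unital_cstar_algebra"
  assumes "n * v = 1" "v * n = 1" "selfadjoint S" "pos n" "pos v"
  shows "pos ((1/2) *\<^sub>R (S * v * S + n) + S)" "pos ((1/2) *\<^sub>R (S * v * S + n) - S)"
proof -
  have st: "star S = S" "star n = n"
    using assms selfadjoint_pos by (auto simp: selfadjoint_def)
  have v: "n * (v * z) = z" "v * (n * z) = z" for z
    using assms(1,2) by (simp_all flip: mult.assoc)
  have "pos ((1/2) *\<^sub>R (star (S + n) * v * (S + n)))" "pos ((1/2) *\<^sub>R (star (S - n) * v * (S - n)))"
    by (intro pos_scaleR pos_conjugate assms; simp)+
  moreover have "star (S + n) * v * (S + n) = (S * v * S + n) + (S + S)"
    "star (S - n) * v * (S - n) = (S * v * S + n) - (S + S)"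
    by (simp_all add: st star_add algebra_simps v assms(1,2))
  ultimately show "pos ((1/2) *\<^sub>R (S * v * S + n) + S)" "pos ((1/2) *\<^sub>R (S * v * S + n) - S)"
    by (simp_all only: scaleR_add_right[of _ _ "S + S"] scaleR_diff_right[of _ _ "S + S"] scaleR_half_double)
qed

text \<open>Inversion reverses the order, so \<open>D v D \<le> D w D \<le> F\<close> for the
  inverses \<open>v\<close> of \<open>m\<close> and \<open>w\<close> of \<open>F\<close>. One
  statement serves both half steps, the second with \<open>S\<close>, \<open>E\<close> for
  \<open>D\<close>, \<open>F\<close>.\<close>

lemma riccati_step:
  fixes D F M m :: "'a::unital_cstar_algebra"
  assumes "closed_subalgebra A" "D \<in> A" "M \<in> A" "m \<in> A" "selfadjoint D"
    and "\<delta> > 0" "pos (F - \<delta> *\<^sub>R 1)" "pos (F - D)" "pos (F + D)" "pos (m - F)"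
  obtains v where "m * v = 1" "v * m = 1" "pos v" "M - D * v * D \<in> A" "pos (M - D * v * D - (M - F))"
proof -
  note C = closed_subalgebraD[OF assms(1)]
  have "pos (m - \<delta> *\<^sub>R 1)"
    using pos_add[OF assms(10,7)] by simp
  then obtain v where v: "v \<in> A" "m * v = 1" "v * m = 1" "pos v"
    using pos_inverse assms(6,1,4) by blast
  obtain w where w: "F * w = 1" "w * F = 1" "pos w"
    using pos_inverse[OF assms(7,6) closed_subalgebra_UNIV UNIV_I] by blast
  have "pos (w - v)"
    using inverse_antimono w v assms(10) by blast
  then have "pos (D * (w - v) * D)"
    using pos_conjugate[of _ D] assms(5) by (simp add: selfadjoint_def)
  then have "pos ((F - D * w * D) + D * (w - v) * D)"
    using pos_schur[OF assms(8,9) w(1,2) assms(5) w(3)] pos_add by blast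
  then have "pos (M - D * v * D - (M - F))"
    by (simp add: algebra_simps)
  moreover have "M - D * v * D \<in> A"
    by (intro C assms v)
  ultimately show thesis
    using that v by blast
qed

text \<open>Here \<open>m\<close> is the iterate \<open>m\<^sub>K\<close>, while \<open>P\<close> and \<open>Q\<close> accumulate the first \<open>K\<close> approximate splittings.\<close>

lemma riccati_iteration:
  fixes S D E M :: "'a::unital_cstar_algebra" and K :: nat
  assumes A: "closed_subalgebra A" "S \<in> A" "D \<in> A" "M \<in> A" and sa: "selfadjoint S" "selfadjoint D"
    and \<delta>: "\<delta> > 0" "pos (E - \<delta> *\<^sub>R 1)" "pos (M - E - \<delta> *\<^sub>R 1)"
    and E: "pos (E - S)" "pos (E + S)" and F: "pos (M - E - D)" "pos (M - E + D)"
  shows "\<exists>P\<in>A. \<exists>Q\<in>A. \<exists>m\<in>A. pos (m - (M - E))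
    \<and> pos (P - real K *\<^sub>R S) \<and> pos (P + real K *\<^sub>R S)
    \<and> pos (Q - real K *\<^sub>R D) \<and> pos (Q + real K *\<^sub>R D)
    \<and> P + Q = real K *\<^sub>R M + (1/2) *\<^sub>R (M - m)"
proof (induction K)
  case 0
  have "pos (M - (M - E))"
    using pos_add[OF \<delta>(2) pos_one_scaleR[of \<delta>]] \<delta>(1) by simp
  moreover have "pos (0::'a)"
    using pos_one_scaleR[of 0] by simp
  ultimately show ?case
    using closed_subalgebraD(7)[OF A(1)] A(4)
    by (intro bexI[of _ 0] bexI[of _ M]) auto
next
  case (Suc K)
  then obtain P Q m where PQ: "P \<in> A" "Q \<in> A" "m \<in> A" "pos (m - (M - E))"
    "pos (P - real K *\<^sub>R S)" "pos (P + real K *\<^sub>R S)"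
    "pos (Q - real K *\<^sub>R D)" "pos (Q + real K *\<^sub>R D)"
    "P + Q = real K *\<^sub>R M + (1/2) *\<^sub>R (M - m)"
    by blast
  note C = closed_subalgebraD[OF A(1)]
  obtain v where v: "m * v = 1" "v * m = 1" "pos v" "M - D * v * D \<in> A" "pos (M - D * v * D - (M - (M - E)))"
    using riccati_step[OF A(1,3,4) PQ(3) sa(2) \<delta>(1,3) F PQ(4)] by blast
  define n where "n = M - D * v * D"
  have n: "n \<in> A" "pos (n - E)"
    using v by (auto simp: n_def)
  obtain w where w: "n * w = 1" "w * n = 1" "pos w" "M - S * w * S \<in> A" "pos (M - S * w * S - (M - E))"
    using riccati_step[OF A(1,2,4) n(1) sa(1) \<delta>(1,2) E n(2)] by blast
  have dp: "pos (\<delta> *\<^sub>R (1::'a))"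
    using \<delta>(1) by (simp add: pos_one_scaleR)
  have pn: "pos n" and pm: "pos m"
    using pos_add[OF pos_add[OF n(2) \<delta>(2)] dp] pos_add[OF pos_add[OF PQ(4) \<delta>(3)] dp] by auto
  define P' where "P' = (1/2) *\<^sub>R (S * w * S + n)"
  define Q' where "Q' = (1/2) *\<^sub>R (D * v * D + m)"
  note P' = pos_completed_square[OF w(1,2) sa(1) pn w(3), folded P'_def]
  note Q' = pos_completed_square[OF v(1,2) sa(2) pm v(3), folded Q'_def]
  \<comment> \<open>Expressed through the iterates, since those, rather than the inverses, are known
    to lie in \<open>A\<close>.\<close>
  have "P' = (1/2) *\<^sub>R (M - (M - S * w * S) + n)" "Q' = (1/2) *\<^sub>R (M - n + m)"
    by (simp_all add: P'_def Q'_def n_def)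
  then have "P' \<in> A" "Q' \<in> A"
    using C(3)[OF C(2)[OF C(6)[OF A(4) w(4)] n(1)]] C(3)[OF C(2)[OF C(6)[OF A(4) n(1)] PQ(3)]] by metis+
  moreover have "pos (P + P' - real (Suc K) *\<^sub>R S)" "pos (P + P' + real (Suc K) *\<^sub>R S)"
    "pos (Q + Q' - real (Suc K) *\<^sub>R D)" "pos (Q + Q' + real (Suc K) *\<^sub>R D)"
    using pos_add[OF PQ(5) P'(2)] pos_add[OF PQ(6) P'(1)] pos_add[OF PQ(7) Q'(2)] pos_add[OF PQ(8) Q'(1)]
    by (simp_all add: algebra_simps)
  \<comment> \<open>In \<open>P' + Q'\<close> the terms \<open>n\<close> and \<open>D v D\<close>
    combine to \<open>M\<close>, leaving \<open>M\<close> plus half the difference of consecutive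
    iterates.\<close>
  moreover have "(P + P') + (Q + Q') = real (Suc K) *\<^sub>R M + (1/2) *\<^sub>R (M - (M - S * w * S))"
  proof -
    have "(P + P') + (Q + Q') = (P + Q) + (P' + Q')"
      by simp
    also have "P' + Q' = (1/2) *\<^sub>R (S * w * S + M + m)"
      by (simp add: P'_def Q'_def n_def flip: scaleR_add_right)
    also have "(P + Q) + \<dots> = real K *\<^sub>R M + (1/2) *\<^sub>R (M + M) + (1/2) *\<^sub>R (S * w * S)"
      unfolding PQ(9) by (simp add: algebra_simps del: scaleR_half_double)
    finally show ?thesis
      by (simp add: algebra_simps scaleR_half_add_half)
  qed
  ultimately show ?case
    using C(2) PQ(1,2) w(4,5) by blast
qed

text \<open>Averages \<open>K\<close> steps of the iteration. The excess of the averaged sum over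
  \<open>M\<close> is \<open>(M - m) / (2 K)\<close>, and positivity of \<open>m\<close> bounds it
  above by \<open>norm M / (2 K)\<close>.\<close>

lemma approximate_splitting:
  fixes S D E M :: "'a::unital_cstar_algebra"
  assumes A: "closed_subalgebra A" "S \<in> A" "D \<in> A" "M \<in> A" and sa: "selfadjoint S" "selfadjoint D"
    and \<delta>: "\<delta> > 0" and E: "pos (E - S - \<delta> *\<^sub>R 1)" "pos (E + S - \<delta> *\<^sub>R 1)"
    and F: "pos (M - E - D - \<delta> *\<^sub>R 1)" "pos (M - E + D - \<delta> *\<^sub>R 1)" and \<eta>: "\<eta> > 0"
  obtains P Q where "P \<in> A" "Q \<in> A" "pos (P - S)" "pos (P + S)" "pos (Q - D)" "pos (Q + D)"
    "pos (M + \<eta> *\<^sub>R 1 - P - Q)"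
proof -
  note C = closed_subalgebraD[OF A(1)]
  have dp: "pos (\<delta> *\<^sub>R (1::'a))"
    using \<delta>(1) by (simp add: pos_one_scaleR)
  have half: "(1/2) *\<^sub>R ((x - y - z) + (x + y - z)) = x - z" for x y z :: 'a
    by (simp add: scaleR_half_add_half algebra_simps)
  \<comment> \<open>Averaging the two strict bounds eliminates \<open>S\<close>, respectively
    \<open>D\<close>, and bounds \<open>E\<close> and \<open>M - E\<close> below by
    \<open>\<delta> 1\<close>.\<close>
  have E': "pos (E - \<delta> *\<^sub>R 1)" "pos (M - E - \<delta> *\<^sub>R 1)"
    using pos_scaleR[OF pos_add[OF E], of "1/2"] pos_scaleR[OF pos_add[OF F], of "1/2"]
    unfolding half by auto
  have mE: "pos E" "pos (M - E)"
    using pos_add[OF E'(1) dp] pos_add[OF E'(2) dp] by auto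
  have ES: "pos (E - S)" "pos (E + S)" "pos (M - E - D)" "pos (M - E + D)"
    using pos_add[OF E(1) dp] pos_add[OF E(2) dp] pos_add[OF F(1) dp] pos_add[OF F(2) dp] by auto
  obtain K0 :: nat where "norm M / \<eta> < real K0"
    using reals_Archimedean2 by blast
  define K where "K = Suc K0"
  have K: "K > 0" "norm M \<le> 2 * real K * \<eta>"
  proof -
    have "norm M \<le> real K0 * \<eta>"
      using \<open>norm M / \<eta> < real K0\<close> \<eta> by (simp add: field_simps)
    also have "\<dots> \<le> 2 * real K * \<eta>"
      using \<eta> by (intro mult_right_mono) (auto simp: K_def)
    finally show "norm M \<le> 2 * real K * \<eta>" .
  qed (simp add: K_def)
  obtain P Q m where PQ: "P \<in> A" "Q \<in> A" "pos (m - (M - E))"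
    "pos (P - real K *\<^sub>R S)" "pos (P + real K *\<^sub>R S)"
    "pos (Q - real K *\<^sub>R D)" "pos (Q + real K *\<^sub>R D)"
    "P + Q = real K *\<^sub>R M + (1/2) *\<^sub>R (M - m)"
    using riccati_iteration[OF A sa \<delta> E' ES, of K] by blast
  have "selfadjoint M"
    using selfadjoint_pos[OF pos_add[OF mE]] by simp
  then have "pos ((2 * real K * \<eta>) *\<^sub>R 1 - M)"
    using pos_norm_minus K by blast
  then have "pos ((1 / (2 * real K)) *\<^sub>R ((2 * real K * \<eta>) *\<^sub>R 1 - M + m))"
    using pos_add[OF PQ(3) mE(2)] by (intro pos_scaleR pos_add) auto
  also have "(1 / (2 * real K)) *\<^sub>R ((2 * real K * \<eta>) *\<^sub>R 1 - M + m)
      = M + \<eta> *\<^sub>R 1 - (1 / real K) *\<^sub>R (P + Q)"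
    unfolding PQ(8) using K(1) by (simp add: algebra_simps)
  finally have "pos (M + \<eta> *\<^sub>R 1 - (1 / real K) *\<^sub>R P - (1 / real K) *\<^sub>R Q)"
    by (simp add: algebra_simps)
  moreover have "pos ((1 / real K) *\<^sub>R P - S)" "pos ((1 / real K) *\<^sub>R P + S)"
    "pos ((1 / real K) *\<^sub>R Q - D)" "pos ((1 / real K) *\<^sub>R Q + D)"
    using PQ(4-7)[THEN pos_scaleR, of "1 / real K"] K(1) by (simp_all add: algebra_simps)
  ultimately show thesis
    using that C(3) PQ(1,2) by blast
qed

section \<open>From approximate splittings to interpolation\<close>

theorem theorem0p3:
  fixes A :: "'a::unital_cstar_algebra set"
  assumes "unital_cstar_subalgebra A"
  shows "TR_property 2 2 A (UNIV :: 'a set)"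
  unfolding TR_property_def
proof (intro allI impI)
  fix x y :: "nat \<Rightarrow> 'a"
  assume x: "\<forall>i\<in>{1..2}. x i \<in> A \<and> selfadjoint (x i)"
    and y: "\<forall>j\<in>{1..2}. y j \<in> A \<and> selfadjoint (y j)"
    and "\<exists>b\<in>UNIV. selfadjoint b
      \<and> (\<forall>i\<in>{1..2}. \<forall>j\<in>{1..2}. cstar_less UNIV (x i) b \<and> cstar_less UNIV b (y j))"
  then obtain b where b: "selfadjoint b" "\<And>i. i \<in> {1..2} \<Longrightarrow> cstar_less UNIV (x i) b"
    "\<And>j. j \<in> {1..2} \<Longrightarrow> cstar_less UNIV b (y j)"
    by blast
  have A: "closed_subalgebra A"
    using assms by (rule closed_subalgebra_cstar)
  note C = closed_subalgebraD[OF A]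
  have xy: "x 1 \<in> A" "x 2 \<in> A" "y 1 \<in> A" "y 2 \<in> A" "selfadjoint (x 1)" "selfadjoint (x 2)"
    "selfadjoint (y 1)" "selfadjoint (y 2)"
    using x y by auto
  obtain d1 d2 d3 d4 where d: "d1 > 0" "d2 > 0" "d3 > 0" "d4 > 0"
    "pos (b - x 1 - d1 *\<^sub>R 1)" "pos (b - x 2 - d2 *\<^sub>R 1)"
    "pos (y 1 - b - d3 *\<^sub>R 1)" "pos (y 2 - b - d4 *\<^sub>R 1)"
    using b(2)[of 1] b(2)[of 2] b(3)[of 1] b(3)[of 2] by (auto elim!: cstar_lessE)
  define \<delta> where "\<delta> = Min {d1, d2, d3, d4}"
  have \<delta>: "\<delta> > 0" "\<delta> \<le> d1" "\<delta> \<le> d2" "\<delta> \<le> d3" "\<delta> \<le> d4"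
    using d by (auto simp: \<delta>_def)
  have weaken: "pos (u - r *\<^sub>R 1)" if "pos (u - e *\<^sub>R 1)" "r \<le> e" for u :: 'a and r e
    using pos_add[OF that(1) pos_one_scaleR[of "e - r"]] that(2) by (simp add: algebra_simps)
  define S where "S = (1/2) *\<^sub>R (x 1 - x 2)"
  define X where "X = (1/2) *\<^sub>R (x 1 + x 2)"
  define D where "D = (1/2) *\<^sub>R (y 1 - y 2)"
  define Y where "Y = (1/2) *\<^sub>R (y 1 + y 2)"
  have XS: "x 1 = X + S" "x 2 = X - S" "y 1 = Y + D" "y 2 = Y - D"
    by (simp_all add: X_def S_def Y_def D_def algebra_simps scaleR_half_add_half)
  have mem: "X \<in> A" "S \<in> A" "Y \<in> A" "D \<in> A"
    using xy by (auto simp: X_def S_def Y_def D_def intro!: C)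
  have sa: "selfadjoint X" "selfadjoint S" "selfadjoint Y" "selfadjoint D"
    using xy by (auto simp: X_def S_def Y_def D_def selfadjoint_def star_add)
  \<comment> \<open>The gap \<open>\<delta>\<close> around \<open>b\<close> is shared: half of it is
    taken off \<open>E\<close> and half off \<open>M - E = Y - b - (\<delta>/2) 1\<close>, leaving
    \<open>\<delta>/2\<close> as the strictness of each part.\<close>
  define E where "E = b - X - (\<delta> / 2) *\<^sub>R 1"
  define M where "M = Y - X - \<delta> *\<^sub>R 1"
  have hd: "(\<delta> / 2) *\<^sub>R u + (\<delta> / 2) *\<^sub>R u = \<delta> *\<^sub>R u"
    "(\<delta> / 2) *\<^sub>R u + ((\<delta> / 2) *\<^sub>R u + w) = \<delta> *\<^sub>R u + w" for u w :: 'a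
    by (simp_all flip: scaleR_add_left add.assoc)
  have "M \<in> A"
    using mem by (auto simp: M_def intro!: C)
  have "E - S - (\<delta>/2) *\<^sub>R 1 = b - x 1 - \<delta> *\<^sub>R 1" "E + S - (\<delta>/2) *\<^sub>R 1 = b - x 2 - \<delta> *\<^sub>R 1"
    "M - E + D - (\<delta>/2) *\<^sub>R 1 = y 1 - b - \<delta> *\<^sub>R 1" "M - E - D - (\<delta>/2) *\<^sub>R 1 = y 2 - b - \<delta> *\<^sub>R 1"
    unfolding XS E_def M_def by (simp_all add: algebra_simps hd)
  then have "pos (E - S - (\<delta>/2) *\<^sub>R 1)" "pos (E + S - (\<delta>/2) *\<^sub>R 1)"
    "pos (M - E - D - (\<delta>/2) *\<^sub>R 1)" "pos (M - E + D - (\<delta>/2) *\<^sub>R 1)"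
    using weaken d \<delta> by simp_all
  then obtain P Q where P: "P \<in> A" "Q \<in> A" "pos (P - S)" "pos (P + S)" "pos (Q - D)" "pos (Q + D)"
    "pos (M + (\<delta>/2) *\<^sub>R 1 - P - Q)"
    using approximate_splitting[OF A mem(2,4) \<open>M \<in> A\<close> sa(2,4)] \<delta>(1) by (metis half_gt_zero)
  \<comment> \<open>The splitting, with error at most \<open>\<delta>/2\<close>, leaves a slack of
    \<open>\<delta>/2\<close> below \<open>Y - X\<close>. The shift by \<open>\<delta>/8\<close> is
    the lower gap; the rest covers an upper gap of \<open>\<delta>/8\<close> with
    \<open>\<delta>/4\<close> to spare.\<close>
  define a where "a = X + P + (\<delta>/8) *\<^sub>R 1"
  have a: "a \<in> A"
    using mem P by (auto simp: a_def intro!: C)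
  have "selfadjoint P"
    using selfadjoint_pos[OF P(3)] sa(2) by (simp add: selfadjoint_def)
  then have "selfadjoint a"
    using sa by (simp add: a_def selfadjoint_def star_add)
  have e: "\<delta>/8 > 0"
    using \<delta>(1) by simp
  have "a - x 1 - (\<delta>/8) *\<^sub>R 1 = P - S" "a - x 2 - (\<delta>/8) *\<^sub>R 1 = P + S"
    unfolding XS a_def by simp_all
  then have lower: "cstar_less A (x 1) a" "cstar_less A (x 2) a"
    using cstar_lessI[OF _ e A xy(1) a] cstar_lessI[OF _ e A xy(2) a] P(3,4) by metis+
  have coeff: "(\<delta>/2) *\<^sub>R u - \<delta> *\<^sub>R u + (\<delta>/4) *\<^sub>R u = - ((\<delta>/8) *\<^sub>R u) - (\<delta>/8) *\<^sub>R u" for u :: 'a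
    by (simp flip: scaleR_add_left scaleR_diff_left scaleR_minus_left)
  have "y 1 - a - (\<delta>/8) *\<^sub>R 1 = (M + (\<delta>/2) *\<^sub>R 1 - P - Q) + (Q + D) + (\<delta>/4) *\<^sub>R 1"
    "y 2 - a - (\<delta>/8) *\<^sub>R 1 = (M + (\<delta>/2) *\<^sub>R 1 - P - Q) + (Q - D) + (\<delta>/4) *\<^sub>R 1"
    using coeff[of 1] unfolding XS a_def M_def by (simp_all add: algebra_simps)
  moreover have "pos ((M + (\<delta>/2) *\<^sub>R 1 - P - Q) + (Q + D) + (\<delta>/4) *\<^sub>R 1)"
    "pos ((M + (\<delta>/2) *\<^sub>R 1 - P - Q) + (Q - D) + (\<delta>/4) *\<^sub>R 1)"
    using \<delta>(1) by (intro pos_add P pos_one_scaleR; simp)+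
  ultimately have upper: "cstar_less A a (y 1)" "cstar_less A a (y 2)"
    using cstar_lessI[OF _ e A a xy(3)] cstar_lessI[OF _ e A a xy(4)] by metis+
  have "{1..2::nat} = {1, 2}"
    by auto
  then show "\<exists>a\<in>A. selfadjoint a
      \<and> (\<forall>i\<in>{1..2}. \<forall>j\<in>{1..2}. cstar_less A (x i) a \<and> cstar_less A a (y j))"
    using a \<open>selfadjoint a\<close> lower upper by auto
qed

end
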